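(* Let $d\ge 2$ be an integer and let $0<\varepsilon\le 1$ be real. If $G$ is a graph on $n\ge 1$ vertices and $\operatorname{mad}(G)\le d-\varepsilon$, then $G$ has a $(d-1)$-degree partition with at most $$1+\frac{(d+\varepsilon+1)^2}{8\varepsilon}\log n$$ sets.
   Context: All graphs are finite and simple. $\log$ is the natural logarithm. The maximum average degree of a graph $G$ is $\operatorname{mad}(G)=\max_{\emptyset\ne H\subseteq G}\frac{2|E(H)|}{|V(H)|}$, the maximum over nonempty subgraphs $H$ of $G$. Let $V_1,\dots,V_t$ be an (ordered) partition of $V(G)$. If $v\in V_i$, a neighbor of $v$ in $V_j$ with $j>i$ is called a later neighbor of $v$. The partition is an $s$-degree partition of $G$ if every $V_i$ is an independent set and every vertex has at most $s$ later neighbors. *)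

theory Defs
  imports Complex_Main "HOL-Library.Disjoint_Sets" "Graph_Theory.Graph_Theory"
begin

text \<open>
  A finite simple graph is a \<^locale>\<open>pair_graph\<close>: finite, loop-free and symmetric. Each undirected
  edge \<open>uv\<close> is represented by the two arcs \<open>(u, v)\<close> and \<open>(v, u)\<close>, so edges
  have to be counted as unordered pairs.
\<close>

definition uedges :: "'a pair_pre_digraph \<Rightarrow> 'a set set" where
  "uedges G = {{u, v} | u v. (u, v) \<in> parcs G}"

text \<open>
  The library's \<^const>\<open>subgraph\<close> also admits non-symmetric arc sets; requiring
  \<^term>\<open>pair_graph H\<close> restricts it to the subgraphs of an undirected graph.
\<close>

definition nonempty_subgraphs :: "'a pair_pre_digraph \<Rightarrow> 'a pair_pre_digraph set" where
  "nonempty_subgraphs G =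
    {H. pair_graph H \<and> subgraph (with_proj H) (with_proj G) \<and> pverts H \<noteq> {}}"

definition mad :: "'a pair_pre_digraph \<Rightarrow> real" where
  "mad G = Max ((\<lambda>H. 2 * real (card (uedges H)) / real (card (pverts H))) ` nonempty_subgraphs G)"

lemma finite_nonempty_subgraphs:
  assumes "pair_graph G"
  shows "finite (nonempty_subgraphs G)"
proof -
  interpret pair_graph G by fact
  have "nonempty_subgraphs G \<subseteq>
      (\<lambda>(V, A). \<lparr>pverts = V, parcs = A\<rparr>) ` (Pow (pverts G) \<times> Pow (parcs G))"
  proof
    fix H assume "H \<in> nonempty_subgraphs G"
    then have "pverts H \<subseteq> pverts G" "parcs H \<subseteq> parcs G"
      by (auto simp: nonempty_subgraphs_def subgraph_def)
    then show "H \<in> (\<lambda>(V, A). \<lparr>pverts = V, parcs = A\<rparr>) ` (Pow (pverts G) \<times> Pow (parcs G))"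
      by (intro image_eqI[where x = "(pverts H, parcs H)"]) auto
  qed
  then show ?thesis
    using pair_finite_verts pair_finite_arcs by (auto intro: finite_subset)
qed

lemma self_in_nonempty_subgraphs:
  assumes "pair_graph G" "pverts G \<noteq> {}"
  shows "G \<in> nonempty_subgraphs G"
proof -
  interpret pair_graph G by fact
  show ?thesis
    using assms wf_digraph
    by (auto simp: nonempty_subgraphs_def subgraph_def compatible_def)
qed

definition independent_set :: "'a pair_pre_digraph \<Rightarrow> 'a set \<Rightarrow> bool" where
  "independent_set G S \<longleftrightarrow> S \<subseteq> pverts G \<and> (\<forall>u\<in>S. \<forall>v\<in>S. (u, v) \<notin> parcs G)"

text \<open>
  An ordered partition \<open>V\<^sub>1, \<dots>, V\<^sub>t\<close> is a list of distinct sets (indexed from 0) that form a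
  \<^const>\<open>partition_on\<close> of the vertex set; in particular all parts are nonempty.
\<close>

definition ordered_partition_on :: "'a set \<Rightarrow> 'a set list \<Rightarrow> bool" where
  "ordered_partition_on A Vs \<longleftrightarrow> distinct Vs \<and> partition_on A (set Vs)"

definition later_neighbors :: "'a pair_pre_digraph \<Rightarrow> 'a set list \<Rightarrow> nat \<Rightarrow> 'a \<Rightarrow> 'a set" where
  "later_neighbors G Vs i v = {w. (v, w) \<in> parcs G \<and> (\<exists>j. i < j \<and> j < length Vs \<and> w \<in> Vs ! j)}"

definition degree_partition :: "nat \<Rightarrow> 'a pair_pre_digraph \<Rightarrow> 'a set list \<Rightarrow> bool" where
  "degree_partition s G Vs \<longleftrightarrow>
    ordered_partition_on (pverts G) Vs \<and>
    (\<forall>i < length Vs. independent_set G (Vs ! i)) \<and>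
    (\<forall>i < length Vs. \<forall>v \<in> Vs ! i. card (later_neighbors G Vs i v) \<le> s)"

end

theory Submission
  imports Defs
begin

text \<open>
  Let \<open>L\<close> be the set of vertices of degree less than \<open>d\<close>, and \<open>H\<close> its complement. The vertices in
  \<open>H\<close> have degree at least \<open>d\<close>, but \<open>H\<close> induces average degree at most \<open>d - \<epsilon>\<close>, so at least
  \<open>\<epsilon> |H|\<close> edges join \<open>L\<close> and \<open>H\<close>. Combined with the bound on the average degree of \<open>G\<close> this yields
  \<open>2 \<epsilon> n \<le> (\<Sum>v\<in>L. d + \<epsilon> - deg\<^sub>L v)\<close>. Since \<open>(d + \<epsilon> - k) (k + 1) \<le> (d + \<epsilon> + 1)\<^sup>2 / 4\<close>, the Caro--Wei
  bound provides an independent set in \<open>L\<close> with at least a fraction \<open>8 \<epsilon> / (d + \<epsilon> + 1)\<^sup>2\<close> of all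
  vertices. Take it as the first part and iterate on the rest.
\<close>

section \<open>The Caro--Wei bound\<close>

text \<open>Greedy argument: choose a vertex of minimum degree, discard its closed neighbourhood and
  recurse. Each chosen vertex pays for the reciprocals of all the vertices discarded with
  it.\<close>

lemma caro_wei:
  fixes E :: "'a rel"
  assumes "finite S" "sym E" "irrefl E"
  shows "\<exists>I\<subseteq>S. (\<forall>u\<in>I. \<forall>v\<in>I. (u, v) \<notin> E) \<and>
    (\<Sum>v\<in>S. 1 / (real (card (E `` {v} \<inter> S)) + 1)) \<le> real (card I)"
  using assms(1)
proof (induction S rule: finite_psubset_induct)
  case (psubset S)
  show ?case
  proof (cases "S = {}")
    case True
    then show ?thesis by auto
  next
    case False
    define deg where "deg T v = card (E `` {v} \<inter> T)" for T v
    obtain v where v: "v \<in> S" "\<And>u. u \<in> S \<Longrightarrow> deg S v \<le> deg S u"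
      using ex_min_if_finite[of "deg S ` S"] psubset(1) False by (fastforce simp: not_less)
    define N where "N = insert v (E `` {v} \<inter> S)"
    have N: "N \<subseteq> S" "finite N" and card_N: "card N = deg S v + 1"
      using v psubset(1) \<open>irrefl E\<close> by (auto simp: N_def deg_def irrefl_def)
    from v have "S - N \<subset> S" by (auto simp: N_def)
    from psubset.IH[OF this] obtain J where J: "J \<subseteq> S - N"
      "\<forall>u\<in>J. \<forall>w\<in>J. (u, w) \<notin> E"
      "(\<Sum>u\<in>S - N. 1 / (real (deg (S - N) u) + 1)) \<le> real (card J)"
      by (auto simp: deg_def)
    \<comment> \<open>Every vertex of \<open>N\<close> has degree at least \<open>deg S v\<close>,
      and \<open>N\<close> has \<open>deg S v + 1\<close> elements, so discarding it costs at most
      1.\<close>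
    have "(\<Sum>u\<in>N. 1 / (real (deg S u) + 1)) \<le> (\<Sum>u\<in>N. 1 / (real (deg S v) + 1))"
      using v N by (intro sum_mono frac_le) auto
    also have "\<dots> = 1" by (simp add: card_N add.commute)
    finally have sum_N: "(\<Sum>u\<in>N. 1 / (real (deg S u) + 1)) \<le> 1" .
    \<comment> \<open>Degrees only shrink when \<open>N\<close> is deleted, so the reciprocals in
      the induction hypothesis are the larger ones.\<close>
    have "(\<Sum>u\<in>S - N. 1 / (real (deg S u) + 1)) \<le> (\<Sum>u\<in>S - N. 1 / (real (deg (S - N) u) + 1))"
      using psubset(1) unfolding deg_def
      by (intro sum_mono frac_le add_right_mono of_nat_mono card_mono) auto
    with J sum_N have "(\<Sum>u\<in>S. 1 / (real (deg S u) + 1)) \<le> real (card J) + 1"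
      using sum.subset_diff[OF N(1) psubset(1), of "\<lambda>u. 1 / (real (deg S u) + 1)"] by simp
    also have "\<dots> = real (card (insert v J))"
    proof -
      have "v \<notin> J" "finite J"
        using J(1) psubset(1) by (auto simp: N_def intro: finite_subset)
      then show ?thesis by simp
    qed
    finally have "(\<Sum>u\<in>S. 1 / (real (deg S u) + 1)) \<le> real (card (insert v J))" .
    moreover have "\<forall>u\<in>insert v J. \<forall>w\<in>insert v J. (u, w) \<notin> E"
      using J \<open>irrefl E\<close> \<open>sym E\<close> by (auto simp: N_def irrefl_def dest: symD)
    moreover have "insert v J \<subseteq> S" using v J by auto
    ultimately show ?thesis unfolding deg_def by blast
  qed
qed

section \<open>Induced subgraphs and the maximum average degree\<close>

definition induced :: "'a pair_pre_digraph \<Rightarrow> 'a set \<Rightarrow> 'a pair_pre_digraph" where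
  "induced G S = \<lparr>pverts = S, parcs = parcs G \<inter> S \<times> S\<rparr>"

lemma induced_simps [simp]:
  "pverts (induced G S) = S" "parcs (induced G S) = parcs G \<inter> S \<times> S"
  by (simp_all add: induced_def)

lemma (in pair_graph) sym_parcs: "sym (parcs G)"
  by (auto intro: symI arcs_symmetric)

lemma (in pair_graph) irrefl_parcs: "irrefl (parcs G)"
  by (auto simp: irrefl_def dest: pair_no_loops)

lemma (in pair_graph) pair_graph_induced:
  assumes "S \<subseteq> pverts G"
  shows "pair_graph (induced G S)"
  using assms pair_finite_verts pair_finite_arcs pair_no_loops sym_parcs
  by unfold_locales (auto simp: symmetric_def sym_def intro: finite_subset)

lemma (in pair_graph) subgraph_induced:
  assumes "S \<subseteq> pverts G"
  shows "subgraph (with_proj (induced G S)) (with_proj G)"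
proof -
  interpret S: pair_graph "induced G S" using assms by (rule pair_graph_induced)
  show ?thesis
    using assms wf_digraph S.wf_digraph by (auto simp: subgraph_def compatible_def)
qed

text \<open>Group the arcs by the edge they represent. Symmetry puts both orientations into each
  fibre, and the absence of loops makes them distinct.\<close>

lemma (in pair_graph) card_parcs: "card (parcs G) = 2 * card (uedges G)"
proof -
  define f :: "'a \<times> 'a \<Rightarrow> 'a set" where "f = (\<lambda>(u, v). {u, v})"
  have uedges: "uedges G = f ` parcs G" by (auto simp: uedges_def f_def)
  have fibre: "card {a \<in> parcs G. f a = e} = 2" if "e \<in> f ` parcs G" for e
  proof -
    from that obtain u v where uv: "(u, v) \<in> parcs G" "e = {u, v}" by (auto simp: f_def)
    have "f a = e \<longleftrightarrow> a = (u, v) \<or> a = (v, u)" for a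
      by (cases a) (simp only: f_def uv(2) prod.case doubleton_eq_iff prod.inject)
    then have "{a \<in> parcs G. f a = e} = {(u, v), (v, u)}"
      using uv(1) arcs_symmetric[OF uv(1)] by blast
    with uv show ?thesis by (auto dest: pair_no_loops)
  qed
  have "card (parcs G) = (\<Sum>e\<in>f ` parcs G. card {a \<in> parcs G. f a = e})"
    using sum.image_gen[OF pair_finite_arcs, of "\<lambda>_. 1::nat" f] by simp
  also have "\<dots> = 2 * card (uedges G)" by (simp add: fibre uedges)
  finally show ?thesis .
qed

text \<open>Subgraphs of \<open>H\<close> are subgraphs of \<open>G\<close>, so the maximum for
  \<open>H\<close> ranges over fewer candidates; \<open>H\<close> itself keeps that range nonempty,
  as \<open>Max_mono\<close> requires.\<close>

lemma mad_mono:
  assumes "pair_graph G" "H \<in> nonempty_subgraphs G"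
  shows "mad H \<le> mad G"
proof -
  from assms have H: "pair_graph H" "pverts H \<noteq> {}" "subgraph (with_proj H) (with_proj G)"
    by (auto simp: nonempty_subgraphs_def)
  then have "nonempty_subgraphs H \<subseteq> nonempty_subgraphs G"
    by (auto simp: nonempty_subgraphs_def intro: subgraph_trans)
  moreover have "H \<in> nonempty_subgraphs H"
    using H by (intro self_in_nonempty_subgraphs)
  ultimately show ?thesis
    unfolding mad_def using finite_nonempty_subgraphs[OF assms(1)]
    by (intro Max_mono image_mono finite_imageI) auto
qed

lemma (in pair_graph) mad_induced:
  assumes "S \<subseteq> pverts G" "S \<noteq> {}"
  shows "mad (induced G S) \<le> mad G"
  using assms pair_graph pair_graph_induced subgraph_induced
  by (intro mad_mono) (auto simp: nonempty_subgraphs_def)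

text \<open>The graph itself competes in the maximum, and counting arcs absorbs the factor 2 in
  \<open>mad\<close>.\<close>

lemma (in pair_graph) card_parcs_le_mad:
  assumes "pverts G \<noteq> {}"
  shows "real (card (parcs G)) \<le> mad G * real (card (pverts G))"
proof -
  have "real (card (parcs G)) / real (card (pverts G)) \<le> mad G"
    unfolding mad_def
    using finite_nonempty_subgraphs[OF pair_graph] self_in_nonempty_subgraphs[OF pair_graph assms]
    by (intro Max_ge) (auto simp: card_parcs)
  moreover have "card (pverts G) > 0"
    using assms pair_finite_verts by (simp add: card_gt_0_iff)
  ultimately show ?thesis by (simp add: field_simps)
qed

section \<open>Large independent sets of low degree\<close>

lemma card_Int_Times:
  fixes E :: "'a rel"
  assumes "finite S" "finite T"
  shows "card (E \<inter> S \<times> T) = (\<Sum>v\<in>S. card (E `` {v} \<inter> T))"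
proof -
  have "E \<inter> S \<times> T = (SIGMA v:S. E `` {v} \<inter> T)" by auto
  then show ?thesis using assms by simp
qed

lemma (in pair_graph) independent_low_degree_set:
  fixes d :: nat and \<epsilon> :: real
  assumes "0 < \<epsilon>" "mad G \<le> real d - \<epsilon>" "pverts G \<noteq> {}"
  shows "\<exists>I. independent_set G I \<and> (\<forall>v\<in>I. card (parcs G `` {v}) < d) \<and>
    8 * \<epsilon> / (real d + \<epsilon> + 1)\<^sup>2 * real (card (pverts G)) \<le> real (card I)"
proof -
  define V where "V = pverts G"
  define E where "E = parcs G"
  define L where "L = {v \<in> V. card (E `` {v}) < d}"
  define H where "H = V - L"
  \<comment> \<open>Since arcs are counted, \<open>a S S\<close> is twice the number of edges inside
    \<open>S\<close>, whereas for disjoint \<open>S\<close> and \<open>T\<close> each edge between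
    them counts once.\<close>
  define a where "a S T = real (card (E \<inter> S \<times> T))" for S T
  have fin: "finite V" "finite L" "finite H"
    using pair_finite_verts by (auto simp: V_def L_def H_def)
  have E: "E \<subseteq> V \<times> V"
    by (auto simp: E_def V_def dest: in_arcsD1 in_arcsD2)
  have V: "V = L \<union> H" "L \<inter> H = {}" by (auto simp: L_def H_def)
  have card_V: "card V = card L + card H"
    unfolding V(1) using fin V(2) by (intro card_Un_disjoint)

  have mad_le: "a S S \<le> (real d - \<epsilon>) * real (card S)" if "S \<subseteq> V" for S
  proof (cases "S = {}")
    case False
    interpret S: pair_graph "induced G S"
      using that by (intro pair_graph_induced) (simp add: V_def)
    have "a S S \<le> mad (induced G S) * real (card S)"
      using S.card_parcs_le_mad False by (simp add: a_def E_def)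
    also have "\<dots> \<le> (real d - \<epsilon>) * real (card S)"
      using mad_induced[of S] that False assms(2) by (intro mult_right_mono) (auto simp: V_def)
    finally show ?thesis .
  qed (simp add: a_def)

  have a_Un1: "a V T = a L T + a H T" if "finite T" for T
  proof -
    have "E \<inter> V \<times> T = (E \<inter> L \<times> T) \<union> (E \<inter> H \<times> T)" using V by auto
    then have "card (E \<inter> V \<times> T) = card (E \<inter> L \<times> T) + card (E \<inter> H \<times> T)"
      using V(2) fin that by (auto intro!: card_Un_disjoint)
    then show ?thesis by (simp add: a_def)
  qed
  have a_commute: "a S T = a T S" for S T
  proof -
    have "E \<inter> T \<times> S = prod.swap ` (E \<inter> S \<times> T)"
      using sym_parcs by (force simp: E_def image_iff dest: symD)
    then show ?thesis by (simp add: a_def card_image)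
  qed

  have "real d * real (card H) = (\<Sum>v\<in>H. real d)" by simp
  also have "\<dots> \<le> (\<Sum>v\<in>H. real (card (E `` {v} \<inter> V)))"
  proof (rule sum_mono)
    fix v assume "v \<in> H"
    moreover have "E `` {v} \<inter> V = E `` {v}" using E by auto
    ultimately show "real d \<le> real (card (E `` {v} \<inter> V))" by (auto simp: H_def L_def)
  qed
  also have "\<dots> = a H V" using fin by (simp add: a_def card_Int_Times)
  also have "\<dots> = a L H + a H H" using a_Un1 fin a_commute by metis
  finally have deg_H: "real d * real (card H) \<le> a L H + a H H" .
  have "a V V = a L V + a H V" using a_Un1 fin by metis
  also have "\<dots> = a L L + 2 * a L H + a H H" using a_Un1 fin a_commute by (smt (verit))
  finally have a_V: "a V V = a L L + 2 * a L H + a H H" .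
  \<comment> \<open>Write \<open>a L L\<close> as \<open>a V V - 2 * (a L H + a H H) + a H H\<close>
    and bound the three terms by \<open>mad_le\<close> for \<open>V\<close>, by
    \<open>deg_H\<close>, and by \<open>mad_le\<close> for \<open>H\<close>. This leaves (d -
    \<epsilon>) |L| - 2 \<epsilon> |H|; adding 2 \<epsilon> |V| cancels the contribution of
    \<open>H\<close>.\<close>
  have "a L L + 2 * \<epsilon> * real (card V) \<le> (real d + \<epsilon>) * real (card L)"
    using mad_le[of V] mad_le[of H] deg_H a_V card_V V(1) by (auto simp: algebra_simps)
  moreover have "a L L = (\<Sum>v\<in>L. real (card (E `` {v} \<inter> L)))"
    using fin by (simp add: a_def card_Int_Times)
  ultimately have "2 * \<epsilon> * real (card V) \<le> (\<Sum>v\<in>L. real d + \<epsilon> - real (card (E `` {v} \<inter> L)))"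
    by (simp add: sum_subtractf algebra_simps)
  also have "\<dots> \<le> (\<Sum>v\<in>L. (real d + \<epsilon> + 1)\<^sup>2 / 4 * (1 / (real (card (E `` {v} \<inter> L)) + 1)))"
  proof (rule sum_mono)
    fix v
    define k where "k = real (card (E `` {v} \<inter> L))"
    \<comment> \<open>AM-GM: the factors d + \<epsilon> - k and k + 1 have the constant sum d +
      \<epsilon> + 1, so their product is at most a quarter of its square.\<close>
    have "0 \<le> (real d + \<epsilon> - k - (k + 1))\<^sup>2" by simp
    then have "(real d + \<epsilon> - k) * (k + 1) \<le> (real d + \<epsilon> + 1)\<^sup>2 / 4"
      by (simp add: power2_eq_square algebra_simps)
    moreover have "k + 1 > 0" by (simp add: k_def add_nonneg_pos)
    ultimately have "real d + \<epsilon> - k \<le> (real d + \<epsilon> + 1)\<^sup>2 / 4 * (1 / (k + 1))"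
      by (simp only: pos_le_divide_eq times_divide_eq_right mult_1_right)
    then show "real d + \<epsilon> - real (card (E `` {v} \<inter> L)) \<le>
        (real d + \<epsilon> + 1)\<^sup>2 / 4 * (1 / (real (card (E `` {v} \<inter> L)) + 1))"
      by (simp only: k_def)
  qed
  also have "\<dots> = (real d + \<epsilon> + 1)\<^sup>2 / 4 * (\<Sum>v\<in>L. 1 / (real (card (E `` {v} \<inter> L)) + 1))"
    by (simp only: sum_distrib_left)
  finally have bound: "2 * \<epsilon> * real (card V) \<le>
    (real d + \<epsilon> + 1)\<^sup>2 / 4 * (\<Sum>v\<in>L. 1 / (real (card (E `` {v} \<inter> L)) + 1))" .

  obtain I where I: "I \<subseteq> L" "\<forall>u\<in>I. \<forall>v\<in>I. (u, v) \<notin> E"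
    "(\<Sum>v\<in>L. 1 / (real (card (E `` {v} \<inter> L)) + 1)) \<le> real (card I)"
    using caro_wei[OF fin(2), of E] sym_parcs irrefl_parcs by (auto simp: E_def)
  note bound
  also have "(real d + \<epsilon> + 1)\<^sup>2 / 4 * (\<Sum>v\<in>L. 1 / (real (card (E `` {v} \<inter> L)) + 1)) \<le>
      (real d + \<epsilon> + 1)\<^sup>2 / 4 * real (card I)"
    using I(3) by (intro mult_left_mono) auto
  finally have "8 * \<epsilon> / (real d + \<epsilon> + 1)\<^sup>2 * real (card V) \<le> real (card I)"
    using assms(1) by (simp add: field_simps)
  moreover have "independent_set G I"
    using I by (auto simp: independent_set_def E_def V_def L_def)
  ultimately show ?thesis using I(1) by (auto simp: L_def E_def V_def)
qed

section \<open>Peeling off the parts\<close>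

lemma (in pair_graph) degree_partition_single:
  assumes "independent_set G (pverts G)" "pverts G \<noteq> {}"
  shows "degree_partition s G [pverts G]"
  using assms
  by (auto simp: degree_partition_def ordered_partition_on_def partition_on_def
    later_neighbors_def)

text \<open>For a vertex of \<open>I\<close> the full degree bounds the number of later neighbors.
  For any other vertex \<open>I\<close> lies earlier, so its later neighbors are those it has in the
  remaining graph.\<close>

lemma (in pair_graph) degree_partition_Cons:
  assumes "independent_set G I" "I \<noteq> {}" "\<forall>v\<in>I. card (parcs G `` {v}) \<le> s"
    and Vs: "degree_partition s (induced G (pverts G - I)) Vs"
  shows "degree_partition s G (I # Vs)"
proof -
  have I: "I \<subseteq> pverts G" using assms(1) by (simp add: independent_set_def)
  have part: "partition_on (pverts G - I) (set Vs)" "distinct Vs"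
    using Vs by (auto simp: degree_partition_def ordered_partition_on_def)
  have sub: "Vs ! i \<subseteq> pverts G - I" if "i < length Vs" for i
    using part(1) that by (auto simp: partition_on_def)
  have ordered: "ordered_partition_on (pverts G) (I # Vs)"
  proof -
    have "I \<notin> set Vs" using part(1) assms(2) by (auto simp: partition_on_def)
    moreover have "partition_on (pverts G) (insert I (set Vs))"
      using part(1) assms(2) I
      by (auto simp: partition_on_def disjoint_insert disjnt_def pairwise_insert)
    ultimately show ?thesis using part(2) by (simp add: ordered_partition_on_def)
  qed
  have later_Suc: "later_neighbors G (I # Vs) (Suc i) v =
      later_neighbors (induced G (pverts G - I)) Vs i v"
    if "i < length Vs" "v \<in> Vs ! i" for i v
  proof -
    \<comment> \<open>Index 0, the place of \<open>I\<close>, is never later than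
      \<open>Suc i\<close>, so the witness merely shifts by one.\<close>
    have "(\<exists>j. Suc i < j \<and> j < length (I # Vs) \<and> w \<in> (I # Vs) ! j) \<longleftrightarrow>
        (\<exists>j. i < j \<and> j < length Vs \<and> w \<in> Vs ! j)" for w
      using Suc_less_eq2 by force
    then show ?thesis using sub that by (auto simp: later_neighbors_def)
  qed
  have "independent_set G ((I # Vs) ! i)" if "i < length (I # Vs)" for i
  proof (cases i)
    case (Suc j)
    with that have j: "j < length Vs" by simp
    with Vs have "independent_set (induced G (pverts G - I)) (Vs ! j)"
      by (simp add: degree_partition_def)
    with Suc show ?thesis by (auto simp: independent_set_def)
  qed (use assms(1) in simp)
  moreover have "card (later_neighbors G (I # Vs) i v) \<le> s"
    if "i < length (I # Vs)" "v \<in> (I # Vs) ! i" for i v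
  proof (cases i)
    case 0
    have "finite (parcs G `` {v})" using pair_finite_arcs by (rule finite_Image)
    then have "card (later_neighbors G (I # Vs) i v) \<le> card (parcs G `` {v})"
      by (intro card_mono) (auto simp: later_neighbors_def)
    with 0 that assms(3) show ?thesis by fastforce
  next
    case (Suc j)
    then show ?thesis using Vs that later_Suc[of j v] by (simp add: degree_partition_def)
  qed
  ultimately show ?thesis using ordered by (simp add: degree_partition_def)
qed

theorem lemma2p4:
  fixes G :: "'a pair_pre_digraph" and d n :: nat and \<epsilon> :: real
  assumes "d \<ge> 2"
    and "0 < \<epsilon>" and "\<epsilon> \<le> 1"
    and "pair_graph G"
    and "card (pverts G) = n" and "n \<ge> 1"
    and "mad G \<le> real d - \<epsilon>"
  shows "\<exists>Vs. degree_partition (d - 1) G Vs \<and>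
    real (length Vs) \<le> 1 + (real d + \<epsilon> + 1)\<^sup>2 / (8 * \<epsilon>) * ln (real n)"
  using assms(4-7)
proof (induction n arbitrary: G rule: less_induct)
  case (less n G)
  interpret pair_graph G by fact
  \<comment> \<open>The reciprocal of \<open>C\<close> is the fraction of the vertices that each
    peeled set is guaranteed to contain.\<close>
  define C where "C = (real d + \<epsilon> + 1)\<^sup>2 / (8 * \<epsilon>)"
  have "C > 0" using \<open>0 < \<epsilon>\<close> by (simp add: C_def)
  have ne: "pverts G \<noteq> {}" using less.prems by auto
  obtain I where I: "independent_set G I" "\<forall>v\<in>I. card (parcs G `` {v}) < d"
    and card_I: "real n / C \<le> real (card I)"
    using independent_low_degree_set[OF \<open>0 < \<epsilon>\<close> less.prems(4) ne] less.prems(2)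
    by (auto simp: C_def mult.commute)
  have "I \<noteq> {}"
    using card_I \<open>n \<ge> 1\<close> \<open>C > 0\<close> by (auto simp: field_simps)
  have "I \<subseteq> pverts G" using I(1) by (simp add: independent_set_def)
  then have "finite I" using pair_finite_verts by (rule finite_subset)
  show ?case
  proof (cases "I = pverts G")
    case True
    then have "degree_partition (d - 1) G [pverts G]"
      using I(1) ne by (intro degree_partition_single) auto
    \<comment> \<open>A single part suffices, and the bound is at least 1 because ln n is
      nonnegative for n \<ge> 1.\<close>
    then show ?thesis using less.prems(3) \<open>0 < \<epsilon>\<close> by (intro exI[of _ "[pverts G]"]) auto
  next
    case False
    define S where "S = pverts G - I"
    define m where "m = card S"
    have S: "S \<subseteq> pverts G" "S \<noteq> {}" using False \<open>I \<subseteq> pverts G\<close> by (auto simp: S_def)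
    then have "m \<ge> 1"
      using pair_finite_verts by (auto simp: m_def Suc_le_eq card_gt_0_iff intro: finite_subset)
    have m: "m = n - card I" "card I \<le> n"
      using \<open>I \<subseteq> pverts G\<close> \<open>finite I\<close> less.prems(2) pair_finite_verts
      by (auto simp: m_def S_def card_Diff_subset card_mono)
    then have "m < n"
      using \<open>I \<noteq> {}\<close> \<open>finite I\<close> \<open>n \<ge> 1\<close> by (simp add: card_gt_0_iff)
    moreover have "mad (induced G S) \<le> real d - \<epsilon>"
      using mad_induced[OF S] less.prems(4) by linarith
    ultimately obtain Vs where Vs: "degree_partition (d - 1) (induced G S) Vs"
      "real (length Vs) \<le> 1 + C * ln (real m)"
      using less.IH[of m "induced G S"] pair_graph_induced[OF S(1)] \<open>m \<ge> 1\<close>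
      by (auto simp: m_def C_def)
    have "degree_partition (d - 1) G (I # Vs)"
      using I Vs(1) \<open>I \<noteq> {}\<close> by (intro degree_partition_Cons) (auto simp: S_def)
    \<comment> \<open>At most the fraction 1 - 1/C of the vertices remains. By ln x \<le> x - 1 at x
      = m/n the logarithm drops by at least 1/C, which after scaling by \<open>C\<close> pays for
      the one new set.\<close>
    moreover have "C * ln (real m) + 1 \<le> C * ln (real n)"
    proof -
      have "ln (real m) - ln (real n) = ln (real m / real n)"
        using \<open>m \<ge> 1\<close> \<open>n \<ge> 1\<close> by (simp add: ln_div)
      also have "\<dots> \<le> real m / real n - 1"
        using \<open>m \<ge> 1\<close> \<open>n \<ge> 1\<close> by (intro ln_le_minus_one) simp
      also have "\<dots> = - (real (card I) / real n)"
        using m \<open>n \<ge> 1\<close> by (simp add: of_nat_diff field_simps)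
      also have "\<dots> \<le> - (1 / C)"
        using card_I \<open>n \<ge> 1\<close> \<open>C > 0\<close> by (simp add: field_simps)
      finally show ?thesis using \<open>C > 0\<close> by (simp add: field_simps)
    qed
    ultimately show ?thesis
      using Vs(2) by (intro exI[of _ "I # Vs"]) (simp add: C_def)
  qed
qed

end
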